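(* Let $R_n(x)$, $S_n(x)$, $T_n(x)$, $n\ge 0$, be the polynomials such that, for all $n\ge0$, $$[\mathrm{Ai}^2(x)]^{(n)}=R_n(x)\mathrm{Ai}^2(x)+2S_n(x)\mathrm{Ai}(x)\mathrm{Ai}'(x)+T_n(x)\mathrm{Ai}'^2(x),$$ $$[\mathrm{Ai}(x)\mathrm{Bi}(x)]^{(n)}=R_n(x)\mathrm{Ai}(x)\mathrm{Bi}(x)+S_n(x)\bigl(\mathrm{Ai}(x)\mathrm{Bi}'(x)+\mathrm{Ai}'(x)\mathrm{Bi}(x)\bigr)+T_n(x)\mathrm{Ai}'(x)\mathrm{Bi}'(x),$$ $$[\mathrm{Bi}^2(x)]^{(n)}=R_n(x)\mathrm{Bi}^2(x)+2S_n(x)\mathrm{Bi}(x)\mathrm{Bi}'(x)+T_n(x)\mathrm{Bi}'^2(x),$$ with $R_0=1$, $S_0=0$, $T_0=0$. Then for every integer $n\ge0$ and every $\delta\in\{0,1\}$, $$T_{2n+\delta+2}(x)=\sum_{\frac{2n+\delta}{3}\le m\le n}\tilde h_{m,n,\delta}\!\left(\tfrac32,0\right)\frac{n!\,\bigl(-\tfrac13\bigr)^{n-m}\,2^{2m+1}\,x^{3m-2n-\delta}}{(n-m)!\,(3m-2n-\delta)!},$$ $$S_{2n+\delta+1}(x)=\sum_{\frac{2n+\delta}{3}\le m\le n}\tilde h_{m,n,\delta}\!\left(\tfrac12,0\right)\frac{n!\,\bigl(-\tfrac13\bigr)^{n-m}\,2^{2m}\,x^{3m-2n-\delta}}{(n-m)!\,(3m-2n-\delta)!},$$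 $$R_{2n+\delta}(x)=\sum_{\frac{2n+\delta}{3}\le m\le n}\left\{\tilde h_{m,n,\delta}\!\left(-\tfrac12,0\right)-[n>0]\,\frac{3m-2n-\delta}{2n}\,\tilde h_{m,n,\delta}\!\left(\tfrac12,1\right)\right\}\frac{n!\,\bigl(-\tfrac13\bigr)^{n-m}\,2^{2m}\,x^{3m-2n-\delta}}{(n-m)!\,(3m-2n-\delta)!},$$ where the sums run over integers $m$ and $$\tilde h_{m,n,\delta}(a,b)=(n+a)_\delta\cdot{}_3F_2\!\left(\begin{matrix}m-n,\;1-a-n,\;n+\delta+a\\ b-n,\;\delta+\tfrac12\end{matrix}\,\Big|\,\frac34\right).$$
   Context: $\mathrm{Ai}$ and $\mathrm{Bi}$ are the standard Airy functions, two linearly independent solutions of $y''=xy$; the superscript $(n)$ denotes the $n$-th derivative. Equivalently, $R_n,S_n,T_n$ are determined by $R_0=1$, $S_0=T_0=0$ and $R_{n+1}=R_n'+2xS_n$, $S_{n+1}=R_n+S_n'+xT_n$, $T_{n+1}=2S_n+T_n'$. $(a)_k=a(a+1)\cdots(a+k-1)$, $(a)_0=1$, is the Pochhammer symbol. $[n>0]$ is Iverson's symbol: it is $1$ if $n>0$, and if $n=0$ the corresponding term is simply removed. An empty sum is $0$. The hypergeometric series is the terminating one: since $m-n$ is a nonpositive integer, $${}_3F_2\!\left(\begin{matrix}m-n,\alpha,\beta\\ b-n,\gamma\end{matrix}\,\Big|\,z\right)=\sum_{k=0}^{n-m}\frac{(m-n)_k(\alpha)_k(\beta)_k}{(b-n)_k(\gamma)_k}\frac{z^k}{k!}.$$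 That is, when there are nonpositive integers among both the upper and the lower parameters, the value is defined as the limit $\epsilon\to0$ of the series with the lower parameter $b-n$ replaced by $b-n+\epsilon$. *)

theory Defs
  imports "HOL-Analysis.Analysis" "HOL-Computational_Algebra.Polynomial"
begin

(* All functions are stated over 'a::{real_normed_field,banach}, so that the variable
   may be real or complex. *)

text \<open>
  Maclaurin coefficients of the solution of $y'' = x y$ with $y(0) = a$, $y'(0) = b$:
  comparing coefficients gives $(n+3)(n+2)\, c_{n+3} = c_n$ and $c_2 = 0$.
\<close>

fun airy_coeff :: "real \<Rightarrow> real \<Rightarrow> nat \<Rightarrow> real" where
  "airy_coeff a b 0 = a"
| "airy_coeff a b (Suc 0) = b"
| "airy_coeff a b (Suc (Suc 0)) = 0"
| "airy_coeff a b (Suc (Suc (Suc n))) = airy_coeff a b n / ((real n + 3) * (real n + 2))"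

definition airy_solution :: "real \<Rightarrow> real \<Rightarrow> 'a \<Rightarrow> 'a::{real_normed_field,banach}" where
  "airy_solution a b x = (\<Sum>n. of_real (airy_coeff a b n) * x ^ n)"

text \<open>
  The standard normalisation:
  $\mathrm{Ai}(0) = 3^{-2/3}/\Gamma(2/3)$, $\mathrm{Ai}'(0) = -3^{-1/3}/\Gamma(1/3)$,
  $\mathrm{Bi}(0) = 3^{-1/6}/\Gamma(2/3)$, $\mathrm{Bi}'(0) = 3^{1/6}/\Gamma(1/3)$.
\<close>

definition airy_Ai :: "'a \<Rightarrow> 'a::{real_normed_field,banach}" where
  "airy_Ai = airy_solution (3 powr (-2/3) / Gamma (2/3)) (- (3 powr (-1/3) / Gamma (1/3)))"

definition airy_Bi :: "'a \<Rightarrow> 'a::{real_normed_field,banach}" where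
  "airy_Bi = airy_solution (3 powr (-1/6) / Gamma (2/3)) (3 powr (1/6) / Gamma (1/3))"

lemma summable_airy_series:
  fixes x :: "'a::{real_normed_field,banach}"
  shows "summable (\<lambda>n. of_real (airy_coeff a b n) * x ^ n)"
proof -
  define r where "r = 2 * norm x + 1"
  have r: "r > 0" by (simp add: r_def add_nonneg_pos)
  define N where "N = nat \<lceil>r ^ 3\<rceil>"
  define u where "u n = \<bar>airy_coeff a b n\<bar> * r ^ n" for n
  define C where "C = (\<Sum>i\<le>N + 2. u i)"
  have u0: "u n \<ge> 0" for n using r by (simp add: u_def)
  have N: "r ^ 3 \<le> real N" unfolding N_def by linarith
  have bound: "u n \<le> C" for n
  proof (induction n rule: less_induct)
    case (less n)
    show ?case
    proof (cases "n \<le> N + 2")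
      case True
      then show ?thesis unfolding C_def using u0 by (intro member_le_sum) auto
    next
      case False
      then obtain k where k: "n = Suc (Suc (Suc k))" "k \<ge> N"
        using that[of "n - 3"] False by simp
      have "1 * real N \<le> (real k + 3) * (real k + 2)"
        using k by (intro mult_mono) auto
      hence q: "r ^ 3 / ((real k + 3) * (real k + 2)) \<le> 1"
        using N by (simp add: divide_le_eq)
      have "u n = u k * (r ^ 3 / ((real k + 3) * (real k + 2)))"
        by (simp add: k u_def abs_mult power3_eq_cube)
      also have "\<dots> \<le> u k * 1" using q u0 by (intro mult_left_mono) auto
      also have "\<dots> \<le> C" using less k by simp
      finally show ?thesis .
    qed
  qed
  have "norm (of_real (airy_coeff a b n) * x ^ n) \<le> C * (1 / 2) ^ n" for n
  proof -
    have "norm (of_real (airy_coeff a b n) * x ^ n) = \<bar>airy_coeff a b n\<bar> * norm x ^ n"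
      by (simp add: norm_mult norm_power)
    also have "\<dots> \<le> \<bar>airy_coeff a b n\<bar> * (r / 2) ^ n"
      by (intro mult_left_mono power_mono) (auto simp: r_def)
    also have "\<dots> = u n * (1 / 2) ^ n" by (simp add: u_def power_divide)
    also have "\<dots> \<le> C * (1 / 2) ^ n" using bound by (intro mult_right_mono) auto
    finally show ?thesis .
  qed
  moreover have "summable (\<lambda>n. C * (1 / 2) ^ n)"
    by (intro summable_mult summable_geometric) simp
  ultimately show ?thesis by (blast intro: summable_comparison_test')
qed

lemma airy_solution_0: "airy_solution a b (0::'a::{real_normed_field,banach}) = of_real a"
  unfolding airy_solution_def by (simp add: powser_zero)

lemma deriv_airy_solution_0:
  "deriv (airy_solution a b) (0::'a::{real_normed_field,banach}) = of_real b"
proof -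
  have "(airy_solution a b has_field_derivative
      (\<Sum>n. diffs (\<lambda>n. of_real (airy_coeff a b n)) n * 0 ^ n)) (at (0::'a))"
    unfolding airy_solution_def[abs_def]
    by (rule termdiffs_strong_converges_everywhere) (rule summable_airy_series)
  then show ?thesis by (simp add: DERIV_imp_deriv powser_zero diffs_def)
qed

lemma airy_solution_ode:
  fixes x :: "'a::{real_normed_field,banach}"
  shows "deriv (deriv (airy_solution a b)) x = x * airy_solution a b x"
proof -
  define c where "c = (\<lambda>n. of_real (airy_coeff a b n) :: 'a)"
  have s: "summable (\<lambda>n. c n * y ^ n)" for y
    unfolding c_def by (rule summable_airy_series)
  have s1: "summable (\<lambda>n. diffs c n * y ^ n)" for y
    by (rule termdiff_converges_all) (rule s)
  have d: "deriv (airy_solution a b) = (\<lambda>y. \<Sum>n. diffs c n * y ^ n)"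
    using termdiffs_strong_converges_everywhere[OF s]
    by (intro ext DERIV_imp_deriv) (simp add: airy_solution_def[abs_def] c_def)
  have "diffs (diffs c) 0 = 0" by (simp add: diffs_def c_def numeral_2_eq_2)
  moreover have "diffs (diffs c) (Suc n) = c n" for n
  proof -
    have "diffs (diffs c) (Suc n) =
        of_real ((real n + 2) * ((real n + 3) * airy_coeff a b (Suc (Suc (Suc n)))))"
      by (simp add: diffs_def c_def add.commute del: airy_coeff.simps)
    also have "(real n + 2) * ((real n + 3) * airy_coeff a b (Suc (Suc (Suc n)))) = airy_coeff a b n"
    proof -
      have "real n + 3 \<noteq> 0" "real n + 2 \<noteq> 0" by linarith+
      then show ?thesis by simp
    qed
    finally show ?thesis by (simp add: c_def)
  qed
  ultimately have "(\<Sum>n. diffs (diffs c) n * x ^ n) = (\<Sum>n. x * (c n * x ^ n))"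
    using suminf_split_head[OF termdiff_converges_all[OF s1], of x] by (simp add: mult_ac)
  also have "\<dots> = x * airy_solution a b x"
    using suminf_mult[OF s, of x x] by (simp add: airy_solution_def c_def)
  finally show ?thesis
    unfolding d by (simp add: DERIV_imp_deriv[OF termdiffs_strong_converges_everywhere[OF s1]])
qed

text \<open>
  The terminating series ${}_3F_2(-N, \alpha, \beta; c, \gamma \,|\, z)$. It is cut off at
  $k = N$ explicitly, because $c$ may itself be a nonpositive integer. As long as $(c)_k$
  vanishes only for $k > N$, this is the limit as $\<epsilon> \<rightarrow> 0$ of the series with $c$ replaced
  by $c + \<epsilon>$.
\<close>

definition hyp3F2_terminating :: "nat \<Rightarrow> 'a \<Rightarrow> 'a \<Rightarrow> 'a \<Rightarrow> 'a \<Rightarrow> 'a \<Rightarrow> 'a::field_char_0" where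
  "hyp3F2_terminating N \<alpha> \<beta> c \<gamma> z =
     (\<Sum>k\<le>N. pochhammer (- of_nat N) k * pochhammer \<alpha> k * pochhammer \<beta> k /
            (pochhammer c k * pochhammer \<gamma> k) * (z ^ k / fact k))"

definition h_tilde :: "nat \<Rightarrow> nat \<Rightarrow> nat \<Rightarrow> 'a \<Rightarrow> 'a \<Rightarrow> 'a::field_char_0" where
  "h_tilde m n \<delta> a b =
     pochhammer (of_nat n + a) \<delta> *
     hyp3F2_terminating (n - m) (1 - a - of_nat n) (of_nat n + of_nat \<delta> + a)
       (b - of_nat n) (of_nat \<delta> + 1 / 2) (3 / 4)"

end

(* A product f of two solutions of y'' = x y satisfies f''' = 4 x f' + 2 f. As the Wronskian of Ai
   and Bi does not vanish, R_n, S_n and T_n are determined by their defining equations at each x, so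
   each of them inherits X_{n+3} = 4 x X_{n+1} + (4n + 2) X_n. With a = s - 1/2, the solution
   V_M = X_{M+s} of this recurrence that starts with 1, 0, 4x is the sum over 2j + 3q = M of
   4^(j+q) e(j,q) x^j, where e(j,q) = e(j-1,q) + (2j + 3q - 2 + a) e(j,q-1). Creative telescoping gives
     e(j,q) = (sum over i of (-1/3)^i (j+q+i)! / i! * binomial(j + 2q + a - 1 - i, q - 2i)) / j!,
   and reading this sum backwards yields the 3F2. Finally T_{M+2} = 2 V_M (a = 3/2),
   S_{M+1} = V_M (a = 1/2) and R_M + x T_M = V_M (a = -1/2); the term x T_M is the second
   summand in the formula for R. *)

theory Submission
  imports Defs
begin

section \<open>Weighted lattice path sums\<close>

text \<open>The binomial coefficient with integer lower index, zero for negative ones: with it the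
  Pascal and absorption identities hold without side conditions.\<close>

definition ibinom :: "'a \<Rightarrow> int \<Rightarrow> 'a::field_char_0" where
  "ibinom y k = (if k < 0 then 0 else y gchoose nat k)"

lemma ibinom_neg [simp]: "k < 0 \<Longrightarrow> ibinom y k = 0"
  by (simp add: ibinom_def)

lemma ibinom_pascal: "ibinom y k = ibinom (y - 1) k + ibinom (y - 1) (k - 1)"
proof (cases "k > 0")
  case True
  then obtain l where "k = int (Suc l)" by (metis gr0_implies_Suc zero_less_imp_eq_int)
  then show ?thesis
    using gbinomial_Suc_Suc[of "y - 1" l] by (simp add: ibinom_def nat_add_distrib)
qed (auto simp: ibinom_def)

lemma ibinom_absorb: "of_int k * ibinom y k = y * ibinom (y - 1) (k - 1)"
proof (cases "k > 0")
  case True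
  then obtain l where "k = int (Suc l)" by (metis gr0_implies_Suc zero_less_imp_eq_int)
  then show ?thesis
    using gbinomial_absorption[of l y] by (simp add: ibinom_def nat_add_distrib)
qed (auto simp: ibinom_def)

text \<open>This is \<open>fact j\<close> times the coefficient e(j, q), indexed by the number m = j
  + q of steps. Without the division by \<open>fact j\<close> the recurrence in \<open>m\<close>
  holds for all \<open>m\<close> and \<open>q\<close>, also at the boundary j = 0. Terms with 2 i >
  q vanish, so the upper bound \<open>q\<close> is only a convenient one.\<close>

definition path_sum :: "'a \<Rightarrow> nat \<Rightarrow> nat \<Rightarrow> 'a::field_char_0" where
  "path_sum a m q = (\<Sum>i\<le>q. (- 1 / 3) ^ i * fact (m + i) / fact i *
     ibinom (of_nat m + of_nat q + a - 1 - of_nat i) (int q - 2 * int i))"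

text \<open>With \<open>k = q - 2 i\<close>, the right-hand side becomes, after multiplication by the weight
  \<open>(- 1 / 3) ^ i * fact (n + i - 1) / fact i\<close>, a difference
  \<open>g i - g (i - 1)\<close>.\<close>

lemma path_sum_term_rec:
  fixes Q n q i :: "'a::field_char_0" and k :: int
  assumes q: "q = of_int k + 2 * i"
  shows "(n + i) * ibinom (Q - i) k - (n - q) * ibinom (Q - 1 - i) k
       - (n + Q - 1) * ibinom (Q - 2 - i) (k - 1)
       = 3 * i * ibinom (Q - 1 - i) k + (n + i) * ibinom (Q - 2 - i) (k - 2)"
proof -
  have 1: "ibinom (Q - i) k = ibinom (Q - 1 - i) k + ibinom (Q - 1 - i) (k - 1)"
    using ibinom_pascal[of "Q - i" k] by (simp add: algebra_simps)
  have 2: "ibinom (Q - 1 - i) (k - 1) = ibinom (Q - 2 - i) (k - 1) + ibinom (Q - 2 - i) (k - 2)"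
    using ibinom_pascal[of "Q - 1 - i" "k - 1"] by (simp add: algebra_simps)
  have 3: "of_int k * ibinom (Q - 1 - i) k = (Q - 1 - i) * ibinom (Q - 2 - i) (k - 1)"
    using ibinom_absorb[of k "Q - 1 - i"] by (simp add: algebra_simps)
  show ?thesis unfolding 1 2 q using 3 by (simp add: algebra_simps)
qed

lemma path_sum_Suc:
  fixes a :: "'a::field_char_0"
  shows "path_sum a (Suc m) q = (of_nat (Suc m) - of_nat q) * path_sum a m q
     + (if q = 0 then 0 else (2 * of_nat m + of_nat q + a) * path_sum a m (q - 1))"
proof -
  define Q where "Q = of_nat m + of_nat q + a"
  \<comment> \<open>The certificate of the telescoping: the last term of
    \<open>path_sum_term_rec\<close> with its weight. The base - 1 / 3 turns the other term, which
    has the factor 3 i, into - g (i - 1).\<close>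
  define g where "g i = (- 1 / 3) ^ i * fact (Suc m + i) / fact i *
     ibinom (Q - 2 - of_nat i) (int q - 2 * int i - 2)" for i
  have *: "(- 1 / 3) ^ i * fact (Suc m + i) / fact i * ibinom (Q - of_nat i) (int q - 2 * int i)
     = (of_nat (Suc m) - of_nat q) * ((- 1 / 3) ^ i * fact (m + i) / fact i *
         ibinom (Q - 1 - of_nat i) (int q - 2 * int i))
     + (2 * of_nat m + of_nat q + a) * ((- 1 / 3) ^ i * fact (m + i) / fact i *
         ibinom (Q - 2 - of_nat i) (int q - 2 * int i - 1))
     + (g i - (if i = 0 then 0 else g (i - 1)))" for i
  proof -
    define w :: 'a where "w = (- 1 / 3) ^ i * fact (m + i) / fact i"
    have f: "(fact (Suc m + i) :: 'a) = (of_nat (Suc m) + of_nat i) * fact (m + i)"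
      by (simp add: algebra_simps)
    have w1: "(- 1 / 3) ^ i * fact (Suc m + i) / fact i = (of_nat (Suc m) + of_nat i) * w"
      unfolding w_def f by simp
    have gi: "g i = (of_nat (Suc m) + of_nat i) * w * ibinom (Q - 2 - of_nat i) (int q - 2 * int i - 2)"
      unfolding g_def w1 by simp
    have gi': "(if i = 0 then 0 else g (i - 1)) =
        - (3 * of_nat i * w * ibinom (Q - 1 - of_nat i) (int q - 2 * int i))"
    proof (cases i)
      case (Suc l)
      have "g l = (- 1 / 3) ^ l * fact (m + i) / fact l * ibinom (Q - 1 - of_nat i) (int q - 2 * int i)"
        unfolding g_def Suc by (simp add: algebra_simps del: fact_Suc)
      also have "(- 1 / 3) ^ l * fact (m + i) / fact l = - 3 * of_nat i * w"
      proof -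
        have "(of_nat (Suc l) :: 'a) \<noteq> 0" by (rule of_nat_neq_0)
        then show ?thesis
          unfolding w_def Suc by (simp add: field_simps del: of_nat_Suc add_Suc_right)
      qed
      finally show ?thesis by (simp add: Suc algebra_simps)
    qed simp
    have k: "(of_nat q :: 'a) = of_int (int q - 2 * int i) + 2 * of_nat i" by simp
    have c: "2 * of_nat m + of_nat q + a = of_nat (Suc m) + Q - 1" by (simp add: Q_def)
    note t = path_sum_term_rec[OF k, of "of_nat (Suc m)" Q]
    show ?thesis unfolding w1 gi gi' c w_def[symmetric]
      using arg_cong[OF t, of "\<lambda>u. w * u"] by (simp add: algebra_simps del: of_nat_Suc)
  qed
  have tel: "(\<Sum>i\<le>N. g i - (if i = 0 then 0 else g (i - 1))) = g N" for N
    by (induction N) auto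
  \<comment> \<open>The differences sum to the boundary value \<open>g q\<close>, whose lower index
    - q - 2 is negative.\<close>
  have "g q = 0" by (simp add: g_def)
  \<comment> \<open>The summand i = q has the lower index - q - 1 and vanishes, which leaves the
    range of \<open>path_sum a m (q - 1)\<close>, or nothing if q = 0.\<close>
  have p: "(\<Sum>i\<le>q. (- 1 / 3) ^ i * fact (m + i) / fact i *
         ibinom (Q - 2 - of_nat i) (int q - 2 * int i - 1)) =
        (if q = 0 then 0 else path_sum a m (q - 1))"
    by (cases q) (simp_all add: path_sum_def Q_def algebra_simps del: fact_Suc)
  have "path_sum a (Suc m) q =
     (\<Sum>i\<le>q. (- 1 / 3) ^ i * fact (Suc m + i) / fact i * ibinom (Q - of_nat i) (int q - 2 * int i))"
    unfolding path_sum_def Q_def by (intro sum.cong refl) (simp add: algebra_simps del: fact_Suc)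
  also have "\<dots> = (of_nat (Suc m) - of_nat q) * path_sum a m q
     + (2 * of_nat m + of_nat q + a) * (if q = 0 then 0 else path_sum a m (q - 1)) + g q"
    unfolding * sum.distrib tel p[symmetric] sum_distrib_left[symmetric]
    by (simp add: path_sum_def Q_def algebra_simps)
  finally show ?thesis using \<open>g q = 0\<close> by simp
qed

text \<open>The total weight of the lattice paths from (0, 0) to (j, q), where a step raising j
  weighs 1 and a step raising q that ends at (j, q) weighs 2 j + 3 q - 2 + a. The recurrence
  \<open>path_coeff_rec\<close> splits off the last step.\<close>

definition path_coeff :: "'a \<Rightarrow> nat \<Rightarrow> nat \<Rightarrow> 'a::field_char_0" where
  "path_coeff a j q = path_sum a (j + q) q / fact j"

lemma path_coeff_0: "path_coeff a 0 0 = 1"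
  by (simp add: path_coeff_def path_sum_def ibinom_def)

lemma path_coeff_rec:
  assumes "j + q > 0"
  shows "path_coeff a j q = (if j = 0 then 0 else path_coeff a (j - 1) q)
     + (if q = 0 then 0 else (2 * of_nat j + 3 * of_nat q - 2 + a) * path_coeff a j (q - 1))"
proof -
  obtain m where m: "j + q = Suc m" using assms by (metis gr0_implies_Suc)
  have j: "(of_nat (Suc m) - of_nat q :: 'a) = of_nat j" using arg_cong[OF m, of "of_nat :: nat \<Rightarrow> 'a"]
    by (simp add: algebra_simps)
  \<comment> \<open>For j = 0 the factor \<open>of_nat j\<close> removes
    \<open>path_sum a m q\<close>, which then has q = m + 1 and belongs to no lattice point.\<close>
  have 1: "of_nat j * path_sum a m q / fact j = (if j = 0 then 0 else path_coeff a (j - 1) q)"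
  proof (cases j)
    case (Suc l)
    have "(of_nat (Suc l) :: 'a) \<noteq> 0" by (rule of_nat_neq_0)
    then show ?thesis using m Suc by (simp add: path_coeff_def field_simps del: of_nat_Suc)
  qed simp
  have 2: "q \<noteq> 0 \<Longrightarrow> j + (q - 1) = m" using m by simp
  have 3: "2 * of_nat m + of_nat q + a = 2 * of_nat j + 3 * of_nat q - 2 + a"
  proof -
    have m': "(of_nat m :: 'a) = of_nat j + of_nat q - 1"
      using arg_cong[OF m, of "of_nat :: nat \<Rightarrow> 'a"] by (simp add: algebra_simps)
    show ?thesis unfolding m' by (simp add: algebra_simps)
  qed
  have "path_coeff a j q = of_nat j * path_sum a m q / fact j
      + (if q = 0 then 0 else (2 * of_nat m + of_nat q + a) * (path_sum a m (q - 1) / fact j))"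
    unfolding path_coeff_def m path_sum_Suc j by (simp add: add_divide_distrib)
  also have "\<dots> = of_nat j * path_sum a m q / fact j
      + (if q = 0 then 0 else (2 * of_nat j + 3 * of_nat q - 2 + a) * path_coeff a j (q - 1))"
  proof (cases "q = 0")
    case False
    then show ?thesis unfolding path_coeff_def 2[OF False] 3 by simp
  qed simp
  finally show ?thesis unfolding 1 .
qed

section \<open>Polynomial solutions of the third-order recurrence\<close>

definition path_poly :: "'a \<Rightarrow> nat \<Rightarrow> 'a \<Rightarrow> 'a::field_char_0" where
  "path_poly a M x = (\<Sum>(j, q) | 2 * j + 3 * q = M. 4 ^ (j + q) * path_coeff a j q * x ^ j)"

lemma finite_weighted_pairs: "finite {(j, q). 2 * j + 3 * q = (M::nat)}"
  by (rule finite_subset[of _ "{..M} \<times> {..M}"]) auto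

lemma path_poly_small: "path_poly a 0 x = 1" "path_poly a (Suc 0) x = 0" "path_poly a 2 x = 4 * x"
proof -
  have "{(j, q). 2 * j + 3 * q = (0::nat)} = {(0, 0)}" by auto
  then show "path_poly a 0 x = 1" by (simp add: path_poly_def path_coeff_0)
  have "{(j, q). 2 * j + 3 * q = Suc 0} = {}" by (auto, presburger)
  then show "path_poly a (Suc 0) x = 0" unfolding path_poly_def by simp
  have "{(j, q). 2 * j + 3 * q = (2::nat)} = {(Suc 0, 0)}" by (auto, presburger+)
  then show "path_poly a 2 x = 4 * x"
    by (simp add: path_poly_def path_coeff_0 path_coeff_rec[of "Suc 0" 0])
qed

text \<open>Every step of a path contributes a factor 4; a last step raising j comes from M + 1 and
  adds a factor x, one raising q comes from M. The weight 2 j + 3 q - 2 + a depends only on 2 j + 3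
  q = M + 3, so it equals M + a + 1 for all pairs and leaves the sum.\<close>

lemma path_poly_rec:
  fixes a :: "'a::field_char_0"
  shows "path_poly a (M + 3) x = 4 * x * path_poly a (M + 1) x + 4 * (of_nat M + a + 1) * path_poly a M x"
proof -
  define P where "P N = {(j, q). 2 * j + 3 * q = (N::nat)}" for N
  have fin: "finite (P N)" for N unfolding P_def by (rule finite_weighted_pairs)
  have "path_poly a (M + 3) x = (\<Sum>(j, q)\<in>P (M + 3).
      (if j = 0 then 0 else 4 ^ (j + q) * path_coeff a (j - 1) q * x ^ j)
      + (if q = 0 then 0 else 4 ^ (j + q) * (of_nat M + a + 1) * path_coeff a j (q - 1) * x ^ j))"
    unfolding path_poly_def P_def
  proof (intro sum.cong refl, clarify)
    fix j q assume e: "2 * j + 3 * q = M + 3"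
    then have "2 * of_nat j + 3 * of_nat q = (of_nat M + 3 :: 'a)"
      by (metis of_nat_add of_nat_mult of_nat_numeral)
    then have c: "2 * of_nat j + 3 * of_nat q - 2 + a = of_nat M + a + 1" by simp
    have "j + q > 0" using e by auto
    from path_coeff_rec[OF this, of a, unfolded c]
    show "4 ^ (j + q) * path_coeff a j q * x ^ j =
      (if j = 0 then 0 else 4 ^ (j + q) * path_coeff a (j - 1) q * x ^ j)
      + (if q = 0 then 0 else 4 ^ (j + q) * (of_nat M + a + 1) * path_coeff a j (q - 1) * x ^ j)"
      by (simp add: algebra_simps)
  qed
  also have "\<dots> = (\<Sum>(j, q)\<in>P (M + 3). if j = 0 then 0 else 4 ^ (j + q) * path_coeff a (j - 1) q * x ^ j)
      + (\<Sum>(j, q)\<in>P (M + 3). if q = 0 then 0 else 4 ^ (j + q) * (of_nat M + a + 1) * path_coeff a j (q - 1) * x ^ j)"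
    by (simp add: sum.distrib case_prod_unfold)
  also have "(\<Sum>(j, q)\<in>P (M + 3). if j = 0 then 0 else 4 ^ (j + q) * path_coeff a (j - 1) q * x ^ j)
      = (\<Sum>(j, q)\<in>P (M + 1). 4 * x * (4 ^ (j + q) * path_coeff a j q * x ^ j))"
  proof -
    have "(\<Sum>(j, q)\<in>P (M + 3). if j = 0 then 0 else 4 ^ (j + q) * path_coeff a (j - 1) q * x ^ j)
      = (\<Sum>(j, q)\<in>{p \<in> P (M + 3). fst p \<noteq> 0}. 4 ^ (j + q) * path_coeff a (j - 1) q * x ^ j)"
      by (rule sum.mono_neutral_cong_right) (use fin in \<open>auto split: if_splits\<close>)
    also have "\<dots> = (\<Sum>(j, q)\<in>P (M + 1). 4 * x * (4 ^ (j + q) * path_coeff a j q * x ^ j))"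
      by (rule sum.reindex_bij_witness[where j = "apfst (\<lambda>j. j - 1)" and i = "apfst Suc"])
        (auto simp: P_def gr0_conv_Suc)
    finally show ?thesis .
  qed
  also have "(\<Sum>(j, q)\<in>P (M + 3). if q = 0 then 0 else 4 ^ (j + q) * (of_nat M + a + 1) * path_coeff a j (q - 1) * x ^ j)
      = (\<Sum>(j, q)\<in>P M. 4 * (of_nat M + a + 1) * (4 ^ (j + q) * path_coeff a j q * x ^ j))"
  proof -
    have "(\<Sum>(j, q)\<in>P (M + 3). if q = 0 then 0 else 4 ^ (j + q) * (of_nat M + a + 1) * path_coeff a j (q - 1) * x ^ j)
      = (\<Sum>(j, q)\<in>{p \<in> P (M + 3). snd p \<noteq> 0}. 4 ^ (j + q) * (of_nat M + a + 1) * path_coeff a j (q - 1) * x ^ j)"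
      by (rule sum.mono_neutral_cong_right) (use fin in \<open>auto split: if_splits\<close>)
    also have "\<dots> = (\<Sum>(j, q)\<in>P M. 4 * (of_nat M + a + 1) * (4 ^ (j + q) * path_coeff a j q * x ^ j))"
      by (rule sum.reindex_bij_witness[where j = "apsnd (\<lambda>q. q - 1)" and i = "apsnd Suc"])
        (auto simp: P_def gr0_conv_Suc)
    finally show ?thesis .
  qed
  finally show ?thesis
    by (simp add: path_poly_def P_def sum_distrib_left case_prod_unfold)
qed

text \<open>Three starting values determine the sequence. As \<open>Y\<close> takes values at one
  fixed point \<open>x\<close>, combinations with coefficients depending on \<open>x\<close>, such
  as R + x T, are admissible.\<close>

lemma path_poly_unique:
  fixes Y :: "nat \<Rightarrow> 'a::field_char_0"
  assumes "Y 0 = c" "Y (Suc 0) = 0" "Y 2 = 4 * x * c"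
    and rec: "\<And>M. Y (M + 3) = 4 * x * Y (M + 1) + 4 * (of_nat M + a + 1) * Y M"
  shows "Y M = c * path_poly a M x"
proof (induction M rule: less_induct)
  case (less M)
  have "M = 0 \<or> M = Suc 0 \<or> M = 2 \<or> M = (M - 3) + 3" by arith
  then consider "M = 0" | "M = Suc 0" | "M = 2" | N where "M = N + 3" by blast
  then show ?case
  proof cases
    case (4 N)
    have "Y N = c * path_poly a N x" "Y (N + 1) = c * path_poly a (N + 1) x"
      using less.IH 4 by auto
    then show ?thesis unfolding 4 rec path_poly_rec by (simp add: algebra_simps)
  qed (use assms path_poly_small[of a x] in auto)
qed

section \<open>Hypergeometric form\<close>

text \<open>Serves both the upper parameter m - n and the lower parameter - n; for k \<le> r no
  factor vanishes, so the truncated series does not divide by zero.\<close>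

lemma pochhammer_minus_of_nat:
  "k \<le> r \<Longrightarrow> pochhammer (- of_nat r) k = ((- 1) ^ k * fact r / fact (r - k) :: 'a::field_char_0)"
proof (induction k)
  case (Suc k)
  have "r - k = Suc (r - Suc k)" using Suc.prems by simp
  then have f: "(fact (r - k) :: 'a) = (of_nat r - of_nat k) * fact (r - Suc k)"
    using Suc.prems by (simp add: of_nat_diff)
  have "(of_nat r - of_nat k :: 'a) \<noteq> 0" using Suc.prems by simp
  then show ?case using Suc by (simp add: pochhammer_Suc f field_simps)
qed simp

text \<open>The duplication formula in its even and odd case at once; it supplies the lower
  parameter \<delta> + 1/2 and the 4 in the argument 3/4.\<close>

lemma pochhammer_half:
  assumes "\<delta> \<in> {0, 1}"
  shows "pochhammer (of_nat \<delta> + 1 / 2) k * fact k * 4 ^ k = (fact (2 * k + \<delta>) :: 'a::field_char_0)"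
proof (induction k)
  case (Suc k)
  have "(fact (2 * Suc k + \<delta>) :: 'a) =
      (of_nat \<delta> + 1 / 2 + of_nat k) * (of_nat k + 1) * 4 * fact (2 * k + \<delta>)"
    using assms by (auto simp: algebra_simps)
  then show ?case unfolding Suc[symmetric] by (simp add: pochhammer_Suc algebra_simps)
qed (use assms in auto)

text \<open>Reversing the sum by i = r - k, with r = n - m, turns the lower index q - 2 i into 2 k +
  \<delta>. The binomial coefficient then yields the prefactor, the two upper parameters other than
  m - n, and \<delta> + 1/2; the factorials of n - k and r - k yield the parameters - n and m - n.
  The powers of 3 and 4 combine to (3/4)^k, and all signs cancel.\<close>

lemma path_coeff_eq_h_tilde:
  fixes a :: "'a::field_char_0"
  assumes d: "\<delta> \<in> {0, 1}" and m: "2 * n + \<delta> \<le> 3 * m" "m \<le> n"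
  shows "path_coeff a (3 * m - 2 * n - \<delta>) (2 * (n - m) + \<delta>) =
    h_tilde m n \<delta> a 0 * (fact n * (- 1 / 3) ^ (n - m) / (fact (n - m) * fact (3 * m - 2 * n - \<delta>)))"
proof -
  define r where "r = n - m"
  have n: "n = m + r" using m by (simp add: r_def)
  define q where "q = 2 * r + \<delta>"
  define F where "F i = (- 1 / 3) ^ i * fact (m + i) / fact i *
     ibinom (of_nat m + of_nat q + a - 1 - of_nat i) (int q - 2 * int i)" for i
  have jq: "3 * m - 2 * n - \<delta> + q = m" using m by (simp add: n q_def)
  have F: "F (r - k) = pochhammer (of_nat n + a) \<delta> *
      (pochhammer (- of_nat r) k * pochhammer (1 - a - of_nat n) k * pochhammer (of_nat n + of_nat \<delta> + a) k /
            (pochhammer (0 - of_nat n) k * pochhammer (of_nat \<delta> + 1 / 2) k) * ((3 / 4) ^ k / fact k))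
      * (fact n * (- 1 / 3) ^ r / fact r)" if k: "k \<le> r" for k
  proof -
    have kn: "k \<le> n" using k n by simp
    have mi: "m + (r - k) = n - k" using k n by simp
    have "int q - 2 * int (r - k) = int (2 * k + \<delta>)" using k by (simp add: q_def of_nat_diff)
    moreover have "of_nat m + of_nat q + a - 1 - of_nat (r - k) = of_nat n + a + of_nat k + of_nat \<delta> - 1"
      using k by (simp add: q_def n of_nat_diff)
    ultimately have "ibinom (of_nat m + of_nat q + a - 1 - of_nat (r - k)) (int q - 2 * int (r - k))
      = (of_nat n + a + of_nat k + of_nat \<delta> - 1) gchoose (2 * k + \<delta>)"
      by (simp only: ibinom_def nat_int of_nat_less_0_iff if_False)
    also have "\<dots> = pochhammer (of_nat n + a - of_nat k) (k + (\<delta> + k)) / fact (2 * k + \<delta>)"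
    proof -
      \<comment> \<open>The rising product is cut into blocks of lengths k, \<delta>, k that start
        at n + a - k, n + a and n + a + \<delta>. The first block, reversed, gives the parameter 1 -
        a - n up to sign.\<close>
      have "2 * k + \<delta> = k + (\<delta> + k)"
        "of_nat n + a + of_nat k + of_nat \<delta> - 1 - of_nat (k + (\<delta> + k)) + 1 = of_nat n + a - of_nat k"
        by simp_all
      then show ?thesis by (simp only: gbinomial_pochhammer')
    qed
    also have "pochhammer (of_nat n + a - of_nat k) (k + (\<delta> + k)) =
        pochhammer (of_nat n + a - of_nat k) k *
        (pochhammer (of_nat n + a) \<delta> * pochhammer (of_nat n + of_nat \<delta> + a) k)"
    proof -
      have "of_nat n + a - of_nat k + of_nat k = of_nat n + a"
        "of_nat n + a + of_nat \<delta> = of_nat n + of_nat \<delta> + a" by simp_all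
      then show ?thesis by (simp only: pochhammer_product')
    qed
    also have "pochhammer (of_nat n + a - of_nat k) k = (- 1) ^ k * pochhammer (1 - a - of_nat n) k"
      using pochhammer_minus[of "of_nat n + a - 1" k] by (simp add: algebra_simps)
    also note pochhammer_half[OF d, of k, where 'a = 'a, symmetric]
    finally have ib: "ibinom (of_nat m + of_nat q + a - 1 - of_nat (r - k)) (int q - 2 * int (r - k)) =
      (- 1) ^ k * pochhammer (1 - a - of_nat n) k *
      (pochhammer (of_nat n + a) \<delta> * pochhammer (of_nat n + of_nat \<delta> + a) k) /
      (pochhammer (of_nat \<delta> + 1 / 2) k * fact k * 4 ^ k)" .
    have nz: "pochhammer (of_nat \<delta> + 1 / 2) k \<noteq> (0::'a)"
      using pochhammer_half[OF d, of k, where 'a = 'a] by (metis fact_nonzero mult_zero_left)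
    have pow: "((- 1 / 3) ^ r :: 'a) = (- 1 / 3) ^ (r - k) * ((- 1) ^ k / 3 ^ k)"
      using k by (metis le_add_diff_inverse2 power_add power_divide)
    \<comment> \<open>The sign is kept as a nonzero atom, so that it cancels by division without a
      case split on the parity of \<open>k\<close>.\<close>
    define e :: 'a where "e = (- 1) ^ k"
    have "e \<noteq> 0" by (simp add: e_def)
    show ?thesis
      unfolding F_def ib mi pow diff_0 pochhammer_minus_of_nat[OF k] pochhammer_minus_of_nat[OF kn]
        power_divide[of 3 4] e_def[symmetric]
      using \<open>e \<noteq> 0\<close> nz by (simp add: field_simps)
  qed
  have "path_coeff a (3 * m - 2 * n - \<delta>) q = (\<Sum>i\<le>q. F i) / fact (3 * m - 2 * n - \<delta>)"
    unfolding path_coeff_def path_sum_def jq F_def ..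
  \<comment> \<open>For i > r the lower index 2 (r - i) + \<delta> is negative because \<delta>
    \<le> 1.\<close>
  also have "(\<Sum>i\<le>q. F i) = (\<Sum>i\<le>r. F i)"
  proof (intro sum.mono_neutral_right ballI)
    fix i assume "i \<in> {..q} - {..r}"
    then have "int q - 2 * int i < 0" using d by (auto simp: q_def)
    then show "F i = 0" by (simp add: F_def)
  qed (auto simp: q_def)
  also have "\<dots> = (\<Sum>k\<le>r. F (r - k))"
    by (rule sum.reindex_bij_witness[where i = "\<lambda>k. r - k" and j = "\<lambda>k. r - k"]) auto
  also have "\<dots> = h_tilde m n \<delta> a 0 * (fact n * (- 1 / 3) ^ r / fact r)"
    unfolding h_tilde_def hyp3F2_terminating_def r_def[symmetric] sum_distrib_left sum_distrib_right
    by (intro sum.cong refl) (use F in simp)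
  finally show ?thesis unfolding q_def r_def by simp
qed

text \<open>The summation index m is the number j + q of steps: together with 2 j + 3 q = 2 n +
  \<delta> this gives j = 3 m - 2 n - \<delta> and q = 2 (n - m) + \<delta>. Thus j \<ge> 0 and q
  \<ge> 0 become the two bounds on m, the second because \<delta> \<le> 1.\<close>

lemma path_poly_eq_h_tilde:
  fixes a :: "'a::field_char_0"
  assumes d: "\<delta> \<in> {0, 1}"
  shows "path_poly a (2 * n + \<delta>) x = (\<Sum>m\<in>{m. 2 * n + \<delta> \<le> 3 * m \<and> m \<le> n}.
         h_tilde m n \<delta> a 0 *
         (fact n * (- 1 / 3) ^ (n - m) * 2 ^ (2 * m) * x ^ (3 * m - 2 * n - \<delta>)
          / (fact (n - m) * fact (3 * m - 2 * n - \<delta>))))"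
proof -
  have "path_poly a (2 * n + \<delta>) x = (\<Sum>m\<in>{m. 2 * n + \<delta> \<le> 3 * m \<and> m \<le> n}.
      2 ^ (2 * m) * path_coeff a (3 * m - 2 * n - \<delta>) (2 * (n - m) + \<delta>) * x ^ (3 * m - 2 * n - \<delta>))"
    unfolding path_poly_def
  proof (rule sum.reindex_bij_witness[where i = "\<lambda>m. (3 * m - 2 * n - \<delta>, 2 * (n - m) + \<delta>)"
        and j = "\<lambda>(j, q). j + q"], goal_cases)
    case (1 p)
    then show ?case using d by (cases p) auto
  next
    case (2 p)
    then show ?case using d by (cases p) auto
  next
    case (5 p)
    obtain j q where p: "p = (j, q)" "2 * j + 3 * q = 2 * n + \<delta>" using 5 by (cases p) auto
    then have jq: "3 * (j + q) - 2 * n - \<delta> = j" "2 * (n - (j + q)) + \<delta> = q" using d by auto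
    have "(2 :: 'a) ^ (2 * (j + q)) = 4 ^ (j + q)" by (simp only: power_mult) simp
    then show ?case unfolding p prod.case jq by simp
  qed (use d in auto)
  also have "\<dots> = (\<Sum>m\<in>{m. 2 * n + \<delta> \<le> 3 * m \<and> m \<le> n}.
         h_tilde m n \<delta> a 0 *
         (fact n * (- 1 / 3) ^ (n - m) * 2 ^ (2 * m) * x ^ (3 * m - 2 * n - \<delta>)
          / (fact (n - m) * fact (3 * m - 2 * n - \<delta>))))"
    by (intro sum.cong refl) (use path_coeff_eq_h_tilde[OF d, of n _ a] in simp)
  finally show ?thesis .
qed

text \<open>The indices and parameters enter only through n - m, n + a, b - n and \<delta>, so
  raising m, n and b by one while lowering a by one changes nothing. This is the origin of the value
  b = 1 in the formula for R.\<close>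

lemma h_tilde_shift:
  "h_tilde (Suc m) (Suc n) \<delta> (1 / 2) 1 = (h_tilde m n \<delta> (3 / 2) 0 :: 'a::field_char_0)"
proof -
  have "1 + of_nat n + (1 / 2 :: 'a) = of_nat n + 3 / 2" "1 - 1 / 2 - (1 + of_nat n :: 'a) = 1 - 3 / 2 - of_nat n"
    "1 + of_nat n + of_nat \<delta> + (1 / 2 :: 'a) = of_nat n + of_nat \<delta> + 3 / 2"
    "1 - (1 + of_nat n) = (0 - of_nat n :: 'a)"
    by (simp_all add: field_simps)
  then show ?thesis by (simp only: h_tilde_def of_nat_Suc diff_Suc_Suc)
qed

text \<open>The left-hand side will be x T at the index 2 n + \<delta>; here it is brought to the
  summation range and the weights of the formula for R.\<close>

lemma path_poly_shift:
  fixes x :: "'a::field_char_0"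
  assumes "n > 0" and d: "\<delta> \<in> {0, 1}"
  shows "2 * x * path_poly (3 / 2) (2 * (n - 1) + \<delta>) x = (\<Sum>m\<in>{m. 2 * n + \<delta> \<le> 3 * m \<and> m \<le> n}.
         of_nat (3 * m - 2 * n - \<delta>) / of_nat (2 * n) * h_tilde m n \<delta> (1 / 2) 1 *
         (fact n * (- 1 / 3) ^ (n - m) * 2 ^ (2 * m) * x ^ (3 * m - 2 * n - \<delta>)
          / (fact (n - m) * fact (3 * m - 2 * n - \<delta>))))"
proof -
  obtain p where n: "n = Suc p" using assms by (metis gr0_implies_Suc)
  show ?thesis
    unfolding path_poly_eq_h_tilde[OF d] sum_distrib_left
  \<comment> \<open>A summand with 3 m = 2 n + \<delta> has no partner under \<open>Suc\<close>, but
    its factor 3 m - 2 n - \<delta> is zero.\<close>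
  proof (rule sum.reindex_bij_witness_not_neutral[where S' = "{}" and i = "\<lambda>m. m - 1" and j = Suc
        and T' = "{m. 2 * n + \<delta> = 3 * m}"], goal_cases)
    case 2
    show ?case by (rule finite_subset[of _ "{..2 * n + \<delta>}"]) auto
  next
    case (9 m)
    then have m: "2 * p + \<delta> \<le> 3 * m" "m \<le> p" by (auto simp: n)
    define j where "j = 3 * m - 2 * p - \<delta>"
    have j: "3 * Suc m - 2 * n - \<delta> = Suc j" using m by (simp add: j_def n)
    have j': "3 * m - 2 * (n - 1) - \<delta> = j" by (simp add: j_def n)
    \<comment> \<open>The quotient J / N lowers the factorials of j + 1 and p + 1 to those of j and
      p; half of the additional factor 4 is the 2 on the left.\<close>
    have cancel: "2 * x * (h * (f * e * t * y / (g * f'))) =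
        J / (2 * N) * h * (N * f * e * (4 * t) * (x * y) / (g * (J * f')))"
      if "J \<noteq> 0" "N \<noteq> 0" "f' \<noteq> 0" for h f e t y g f' J N :: 'a
      using that by (simp add: field_simps)
    have 2: "of_nat (2 * Suc p) = 2 * (of_nat (Suc p) :: 'a)" by simp
    show ?case unfolding j j' unfolding n h_tilde_shift 2
      using cancel[of "of_nat (Suc j)" "of_nat (Suc p)" "fact j"] by (simp del: of_nat_Suc)
  qed (use d in \<open>auto simp: n\<close>)
qed

section \<open>Products of Airy functions\<close>

text \<open>An equation for \<open>deriv\<close> does not yet give differentiability, which the
  derivative rules require. It comes from termwise differentiation of the everywhere convergent
  series.\<close>

lemma has_field_derivative_airy_solution:
  fixes x :: "'a::{real_normed_field,banach}"
  shows "(airy_solution a b has_field_derivative deriv (airy_solution a b) x) (at x)"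
    and "(deriv (airy_solution a b) has_field_derivative x * airy_solution a b x) (at x)"
proof -
  define c where "c = (\<lambda>n. of_real (airy_coeff a b n) :: 'a)"
  have s: "summable (\<lambda>n. c n * y ^ n)" for y
    unfolding c_def by (rule summable_airy_series)
  have s1: "summable (\<lambda>n. diffs c n * y ^ n)" for y
    by (rule termdiff_converges_all) (rule s)
  have 1: "(airy_solution a b has_field_derivative (\<Sum>n. diffs c n * y ^ n)) (at y)" for y
    using termdiffs_strong_converges_everywhere[OF s] by (simp add: airy_solution_def[abs_def] c_def)
  then have d: "deriv (airy_solution a b) = (\<lambda>y. \<Sum>n. diffs c n * y ^ n)"
    by (intro ext DERIV_imp_deriv)
  show "(airy_solution a b has_field_derivative deriv (airy_solution a b) x) (at x)"
    unfolding d by (rule 1)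
  have "(deriv (airy_solution a b) has_field_derivative (\<Sum>n. diffs (diffs c) n * x ^ n)) (at x)"
    unfolding d by (rule termdiffs_strong_converges_everywhere[OF s1])
  then show "(deriv (airy_solution a b) has_field_derivative x * airy_solution a b x) (at x)"
    using airy_solution_ode[of a b x] DERIV_imp_deriv by metis
qed

text \<open>The Wronskian has derivative 0 because y'' = x y has no first-order term, so it equals
  its value at 0. There Ai, Bi and Bi' are positive and Ai' is negative, which makes it a sum of two
  positive products.\<close>

lemma airy_wronskian_nonzero:
  "airy_Ai x * deriv airy_Bi x - deriv airy_Ai x * airy_Bi x \<noteq> (0::'a::{real_normed_field,banach})"
proof -
  define W where "W x = airy_Ai x * deriv airy_Bi x - deriv airy_Ai x * airy_Bi x" for x :: 'a
  have "(W has_field_derivative 0) (at x)" for x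
    unfolding W_def[abs_def] airy_Ai_def airy_Bi_def
    by (rule derivative_eq_intros has_field_derivative_airy_solution refl)+ (simp add: algebra_simps)
  then obtain c where "\<And>x. x \<in> UNIV \<Longrightarrow> W x = c"
    using has_field_derivative_zero_constant[of UNIV W] by auto
  then have "W x = W 0" by simp
  also have "W 0 = of_real (3 powr (-2/3) / Gamma (2/3) * (3 powr (1/6) / Gamma (1/3))
      + 3 powr (-1/3) / Gamma (1/3) * (3 powr (-1/6) / Gamma (2/3)))"
    unfolding W_def airy_Ai_def airy_Bi_def airy_solution_0 deriv_airy_solution_0 by simp
  also have "\<dots> \<noteq> 0"
  proof -
    have "Gamma (2/3) > (0::real)" "Gamma (1/3) > (0::real)" by (auto intro: Gamma_real_pos)
    then have "3 powr (-2/3) / Gamma (2/3) * (3 powr (1/6) / Gamma (1/3))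
      + 3 powr (-1/3) / Gamma (1/3) * (3 powr (-1/6) / Gamma (2/3)) > (0::real)"
      by (intro add_pos_pos mult_pos_pos divide_pos_pos) auto
    then show ?thesis by (metis less_irrefl of_real_eq_0_iff)
  qed
  finally show ?thesis by (simp add: W_def)
qed

text \<open>The recurrence is the n-th derivative of f''' = 4 x f' + 2 f: each differentiation of
  the product with 4 x adds another 4 to the last coefficient. The representation
  \<open>repr\<close> guarantees that all the iterated derivatives are differentiable.\<close>

lemma airy_product_derivs:
  fixes u v u' v' :: "'a::real_normed_field \<Rightarrow> 'a" and R S T :: "nat \<Rightarrow> 'a poly"
  assumes u: "\<And>x. (u has_field_derivative u' x) (at x)"
      "\<And>x. (u' has_field_derivative x * u x) (at x)"
    and v: "\<And>x. (v has_field_derivative v' x) (at x)"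
      "\<And>x. (v' has_field_derivative x * v x) (at x)"
    and repr: "\<And>n x. (deriv ^^ n) (\<lambda>x. u x * v x) x =
      poly (R n) x * (u x * v x) + poly (S n) x * (u x * v' x + u' x * v x) + poly (T n) x * (u' x * v' x)"
  shows "deriv (\<lambda>x. u x * v x) = (\<lambda>x. u x * v' x + u' x * v x)"
    and "(deriv ^^ 2) (\<lambda>x. u x * v x) = (\<lambda>x. 2 * x * (u x * v x) + 2 * (u' x * v' x))"
    and "(deriv ^^ (n + 3)) (\<lambda>x. u x * v x) x =
      4 * x * (deriv ^^ (n + 1)) (\<lambda>x. u x * v x) x + (4 * of_nat n + 2) * (deriv ^^ n) (\<lambda>x. u x * v x) x"
proof -
  define D where "D n = (deriv ^^ n) (\<lambda>x. u x * v x)" for n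
  show D1: "deriv (\<lambda>x. u x * v x) = (\<lambda>x. u x * v' x + u' x * v x)"
    by (rule ext, rule DERIV_imp_deriv) (rule derivative_eq_intros u v refl | simp)+
  have "deriv (\<lambda>x. u x * v' x + u' x * v x) = (\<lambda>x. 2 * x * (u x * v x) + 2 * (u' x * v' x))"
    by (rule ext, rule DERIV_imp_deriv) (rule derivative_eq_intros u v refl | simp add: algebra_simps)+
  then show D2: "(deriv ^^ 2) (\<lambda>x. u x * v x) = (\<lambda>x. 2 * x * (u x * v x) + 2 * (u' x * v' x))"
    by (simp add: numeral_2_eq_2 D1)
  have "deriv (\<lambda>x. 2 * x * (u x * v x) + 2 * (u' x * v' x)) =
      (\<lambda>x. 4 * x * (u x * v' x + u' x * v x) + 2 * (u x * v x))"
    by (rule ext, rule DERIV_imp_deriv) (rule derivative_eq_intros u v refl | simp add: algebra_simps)+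
  then have D3: "D 3 = (\<lambda>x. 4 * x * (u x * v' x + u' x * v x) + 2 * (u x * v x))"
    using D2 by (simp add: D_def numeral_3_eq_3 numeral_2_eq_2)
  have DS: "D (Suc n) = deriv (D n)" for n by (simp add: D_def)
  have D': "(D n has_field_derivative D (Suc n) x) (at x)" for n x
  proof -
    have "D n = (\<lambda>x. poly (R n) x * (u x * v x) + poly (S n) x * (u x * v' x + u' x * v x)
        + poly (T n) x * (u' x * v' x))"
      unfolding D_def by (rule ext) (rule repr)
    \<comment> \<open>Only the existence of a derivative matters; its value is
      \<open>deriv (D n) x\<close> by uniqueness.\<close>
    moreover have "\<exists>d. ((\<lambda>x. poly (R n) x * (u x * v x) + poly (S n) x * (u x * v' x + u' x * v x)
        + poly (T n) x * (u' x * v' x)) has_field_derivative d) (at x)"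
      by (rule exI) (rule derivative_eq_intros u v poly_DERIV refl)+
    ultimately obtain d where "(D n has_field_derivative d) (at x)" by metis
    then show ?thesis unfolding DS using DERIV_imp_deriv by metis
  qed
  have "D (n + 3) = (\<lambda>x. 4 * x * D (n + 1) x + (4 * of_nat n + 2) * D n x)" for n
  proof (induction n)
    case 0
    show ?case using D1 by (simp add: D3) (simp add: D_def)
  next
    case (Suc n)
    have "D (Suc n + 3) = deriv (D (n + 3))" using DS[of "n + 3"] by simp
    also have "\<dots> = (\<lambda>x. 4 * x * D (Suc n + 1) x + (4 * of_nat (Suc n) + 2) * D (Suc n) x)"
      unfolding Suc by (rule ext, rule DERIV_imp_deriv)
        ((rule derivative_eq_intros D' refl)+, simp add: algebra_simps)
    finally show ?case .
  qed
  then show "(deriv ^^ (n + 3)) (\<lambda>x. u x * v x) x =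
      4 * x * (deriv ^^ (n + 1)) (\<lambda>x. u x * v x) x + (4 * of_nat n + 2) * (deriv ^^ n) (\<lambda>x. u x * v x) x"
    by (simp add: D_def fun_eq_iff)
qed

text \<open>The system is the symmetric square of a 2 x 2 system with determinant W = A B' - A' B,
  so elimination leads to W^2. For instance, the weights B'^2, - 2 A' B', A'^2 on the three
  equations isolate (r - r') W^2.\<close>

lemma quadratic_form_unique:
  fixes A :: "'a::field_char_0"
  assumes W: "A * B' - A' * B \<noteq> 0"
    and 1: "r * (A * A) + s * (A * A' + A' * A) + t * (A' * A') = r' * (A * A) + s' * (A * A' + A' * A) + t' * (A' * A')"
    and 2: "r * (A * B) + s * (A * B' + A' * B) + t * (A' * B') = r' * (A * B) + s' * (A * B' + A' * B) + t' * (A' * B')"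
    and 3: "r * (B * B) + s * (B * B' + B' * B) + t * (B' * B') = r' * (B * B) + s' * (B * B' + B' * B) + t' * (B' * B')"
  shows "r = r' \<and> s = s' \<and> t = t'"
proof -
  have "(r - r') * (A * B' - A' * B)\<^sup>2 = 0" using 1 2 3 by algebra
  moreover have "(s - s') * (A * B' - A' * B)\<^sup>2 = 0" using 1 2 3 by algebra
  moreover have "(t - t') * (A * B' - A' * B)\<^sup>2 = 0" using 1 2 3 by algebra
  ultimately show ?thesis using W by simp
qed


section \<open>Identification of R, S and T with the polynomial solutions\<close>

theorem mainTheorem2:
  fixes R S T :: "nat \<Rightarrow> 'a::{real_normed_field,banach} poly"
    and n \<delta> :: nat and x :: 'a
  assumes Ai_Ai: "\<And>(n::nat) (x::'a).
      (deriv ^^ n) (\<lambda>x. (airy_Ai x)\<^sup>2) x =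
        poly (R n) x * (airy_Ai x)\<^sup>2
        + 2 * poly (S n) x * airy_Ai x * deriv airy_Ai x
        + poly (T n) x * (deriv airy_Ai x)\<^sup>2"
    and Ai_Bi: "\<And>(n::nat) (x::'a).
      (deriv ^^ n) (\<lambda>x. airy_Ai x * airy_Bi x) x =
        poly (R n) x * airy_Ai x * airy_Bi x
        + poly (S n) x * (airy_Ai x * deriv airy_Bi x + deriv airy_Ai x * airy_Bi x)
        + poly (T n) x * deriv airy_Ai x * deriv airy_Bi x"
    and Bi_Bi: "\<And>(n::nat) (x::'a).
      (deriv ^^ n) (\<lambda>x. (airy_Bi x)\<^sup>2) x =
        poly (R n) x * (airy_Bi x)\<^sup>2
        + 2 * poly (S n) x * airy_Bi x * deriv airy_Bi x
        + poly (T n) x * (deriv airy_Bi x)\<^sup>2"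
    and init: "R 0 = 1" "S 0 = 0" "T 0 = 0"
    and \<delta>: "\<delta> \<in> {0, 1}"
  shows "poly (T (2 * n + \<delta> + 2)) x =
      (\<Sum>m\<in>{m. 2 * n + \<delta> \<le> 3 * m \<and> m \<le> n}.
         h_tilde m n \<delta> (3 / 2) 0 *
         (fact n * (- 1 / 3) ^ (n - m) * 2 ^ (2 * m + 1) * x ^ (3 * m - 2 * n - \<delta>)
          / (fact (n - m) * fact (3 * m - 2 * n - \<delta>))))
    \<and> poly (S (2 * n + \<delta> + 1)) x =
      (\<Sum>m\<in>{m. 2 * n + \<delta> \<le> 3 * m \<and> m \<le> n}.
         h_tilde m n \<delta> (1 / 2) 0 *
         (fact n * (- 1 / 3) ^ (n - m) * 2 ^ (2 * m) * x ^ (3 * m - 2 * n - \<delta>)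
          / (fact (n - m) * fact (3 * m - 2 * n - \<delta>))))
    \<and> poly (R (2 * n + \<delta>)) x =
      (\<Sum>m\<in>{m. 2 * n + \<delta> \<le> 3 * m \<and> m \<le> n}.
         (h_tilde m n \<delta> (- 1 / 2) 0
          - (if n > 0
             then of_nat (3 * m - 2 * n - \<delta>) / of_nat (2 * n) * h_tilde m n \<delta> (1 / 2) 1
             else 0)) *
         (fact n * (- 1 / 3) ^ (n - m) * 2 ^ (2 * m) * x ^ (3 * m - 2 * n - \<delta>)
          / (fact (n - m) * fact (3 * m - 2 * n - \<delta>))))"
proof -
  have Ai: "(airy_Ai has_field_derivative deriv airy_Ai x) (at x)"
      "(deriv airy_Ai has_field_derivative x * airy_Ai x) (at x)"
    and Bi: "(airy_Bi has_field_derivative deriv airy_Bi x) (at x)"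
      "(deriv airy_Bi has_field_derivative x * airy_Bi x) (at x)" for x :: 'a
    unfolding airy_Ai_def airy_Bi_def by (rule has_field_derivative_airy_solution)+
  \<comment> \<open>Squares are written as products so that the same lemmas apply to all three pairs
    of solutions.\<close>
  have AA: "(deriv ^^ n) (\<lambda>x. airy_Ai x * airy_Ai x) x = poly (R n) x * (airy_Ai x * airy_Ai x)
      + poly (S n) x * (airy_Ai x * deriv airy_Ai x + deriv airy_Ai x * airy_Ai x)
      + poly (T n) x * (deriv airy_Ai x * deriv airy_Ai x)" for n x
    using Ai_Ai[of n x] by (simp add: power2_eq_square algebra_simps)
  have AB: "(deriv ^^ n) (\<lambda>x. airy_Ai x * airy_Bi x) x = poly (R n) x * (airy_Ai x * airy_Bi x)
      + poly (S n) x * (airy_Ai x * deriv airy_Bi x + deriv airy_Ai x * airy_Bi x)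
      + poly (T n) x * (deriv airy_Ai x * deriv airy_Bi x)" for n x
    using Ai_Bi[of n x] by (simp add: mult.assoc)
  have BB: "(deriv ^^ n) (\<lambda>x. airy_Bi x * airy_Bi x) x = poly (R n) x * (airy_Bi x * airy_Bi x)
      + poly (S n) x * (airy_Bi x * deriv airy_Bi x + deriv airy_Bi x * airy_Bi x)
      + poly (T n) x * (deriv airy_Bi x * deriv airy_Bi x)" for n x
    using Bi_Bi[of n x] by (simp add: power2_eq_square algebra_simps)
  note AA' = airy_product_derivs[OF Ai Ai AA] and AB' = airy_product_derivs[OF Ai Bi AB]
    and BB' = airy_product_derivs[OF Bi Bi BB]
  note unique = quadratic_form_unique[OF airy_wronskian_nonzero[of x]]
  have 1: "poly (R 1) x = 0 \<and> poly (S 1) x = 1 \<and> poly (T 1) x = 0"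
    using AA[of 1 x] AB[of 1 x] BB[of 1 x] by (intro unique) (simp_all add: AA'(1) AB'(1) BB'(1))
  have 2: "poly (R 2) x = 2 * x \<and> poly (S 2) x = 0 \<and> poly (T 2) x = 2"
    using AA[of 2 x] AB[of 2 x] BB[of 2 x] by (intro unique) (simp_all only: AA'(2) AB'(2) BB'(2), simp_all)
  have rec: "poly (R (n + 3)) x = 4 * x * poly (R (n + 1)) x + (4 * of_nat n + 2) * poly (R n) x \<and>
      poly (S (n + 3)) x = 4 * x * poly (S (n + 1)) x + (4 * of_nat n + 2) * poly (S n) x \<and>
      poly (T (n + 3)) x = 4 * x * poly (T (n + 1)) x + (4 * of_nat n + 2) * poly (T n) x" for n
    using AA'(3)[of n x, unfolded AA] AB'(3)[of n x, unfolded AB] BB'(3)[of n x, unfolded BB]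
    by (intro unique) (simp_all only: distrib_left distrib_right mult.assoc add.assoc, simp_all add: algebra_simps)
  \<comment> \<open>The offset 2 gives the starting values 2, 0, 8 x, and 4 (M + 2) + 2 = 4 (M + 3/2
    + 1).\<close>
  have T: "poly (T (M + 2)) x = 2 * path_poly (3 / 2) M x" for M
  proof (rule path_poly_unique)
    show "poly (T (N + 3 + 2)) x = 4 * x * poly (T (N + 1 + 2)) x + 4 * (of_nat N + 3 / 2 + 1) * poly (T (N + 2)) x" for N
      using rec[of "N + 2"] by (simp add: algebra_simps numeral_eq_Suc)
  qed (use 1 2 rec[of 0] rec[of 1] init in \<open>simp_all add: numeral_eq_Suc\<close>)
  have S: "poly (S (M + 1)) x = 1 * path_poly (1 / 2) M x" for M
  proof (rule path_poly_unique)
    show "poly (S (N + 3 + 1)) x = 4 * x * poly (S (N + 1 + 1)) x + 4 * (of_nat N + 1 / 2 + 1) * poly (S (N + 1)) x" for N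
      using rec[of "N + 1"] by (simp add: algebra_simps numeral_eq_Suc)
  qed (use 1 2 rec[of 0] init in \<open>simp_all add: numeral_eq_Suc\<close>)
  \<comment> \<open>The sequence R starts with 1, 0, 2 x instead of 1, 0, 4 x. Since x T satisfies
    the same recurrence and starts with 0, 0, 2 x, adding it supplies the missing 2 x.\<close>
  have R: "poly (R M) x + x * poly (T M) x = 1 * path_poly (- 1 / 2) M x" for M
  proof (rule path_poly_unique)
    show "poly (R (N + 3)) x + x * poly (T (N + 3)) x = 4 * x * (poly (R (N + 1)) x + x * poly (T (N + 1)) x)
        + 4 * (of_nat N + - 1 / 2 + 1) * (poly (R N) x + x * poly (T N) x)" for N
      using rec[of N] by (simp add: algebra_simps)
  qed (use 1 2 init in \<open>simp_all add: numeral_eq_Suc\<close>)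
  have xT: "x * poly (T (2 * n + \<delta>)) x = (\<Sum>m\<in>{m. 2 * n + \<delta> \<le> 3 * m \<and> m \<le> n}.
      (if n > 0 then of_nat (3 * m - 2 * n - \<delta>) / of_nat (2 * n) * h_tilde m n \<delta> (1 / 2) 1 else 0) *
         (fact n * (- 1 / 3) ^ (n - m) * 2 ^ (2 * m) * x ^ (3 * m - 2 * n - \<delta>)
          / (fact (n - m) * fact (3 * m - 2 * n - \<delta>))))"
  proof (cases "n > 0")
    case True
    then have "2 * n + \<delta> = (2 * (n - 1) + \<delta>) + 2" by simp
    then have *: "x * poly (T (2 * n + \<delta>)) x = 2 * x * path_poly (3 / 2) (2 * (n - 1) + \<delta>) x"
      by (simp only: T mult_ac)
    show ?thesis unfolding * path_poly_shift[OF True \<delta>] using True by simp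
  next
    case False
    \<comment> \<open>For n = 0 the index is 0 or 1, where T vanishes; this matches the removed
      bracket term.\<close>
    then show ?thesis using \<delta> init 1 by auto
  qed
  have "poly (T (2 * n + \<delta> + 2)) x = (\<Sum>m\<in>{m. 2 * n + \<delta> \<le> 3 * m \<and> m \<le> n}.
         h_tilde m n \<delta> (3 / 2) 0 *
         (fact n * (- 1 / 3) ^ (n - m) * 2 ^ (2 * m + 1) * x ^ (3 * m - 2 * n - \<delta>)
          / (fact (n - m) * fact (3 * m - 2 * n - \<delta>))))"
    unfolding T path_poly_eq_h_tilde[OF \<delta>] sum_distrib_left
    by (intro sum.cong refl) (simp add: mult_ac)
  moreover have "poly (R (2 * n + \<delta>)) x = path_poly (- 1 / 2) (2 * n + \<delta>) x - x * poly (T (2 * n + \<delta>)) x"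
    using R[of "2 * n + \<delta>"] by (simp add: algebra_simps)
  ultimately show ?thesis
    using S[of "2 * n + \<delta>"] path_poly_eq_h_tilde[OF \<delta>, of "1 / 2" n x]
    unfolding xT path_poly_eq_h_tilde[OF \<delta>, of "- 1 / 2"] left_diff_distrib sum_subtractf by simp
qed

end
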